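(* Let $a<b$ be real numbers and let $f:[a,b]\rightarrow\mathbb{R}$ be continuous on $[a,b]$ and twice differentiable on $(a,b)$, with second derivative $f'':(a,b)\rightarrow\mathbb{R}$ belonging to $L_1(a,b)$. Let $I_n: a=x_0<x_1<\dots<x_{n-1}<x_n=b$ be a division of $[a,b]$ and let $h_i=x_{i+1}-x_i$ for $i=0,1,\dots,n-1$. Then $$\int_a^bf(x)\,dx=T(f,f',I_n)+R_T(f,f',I_n),$$ where $$T(f,f',I_n)=\frac12\sum_{i=0}^{n-1}h_i\left(f(x_i)+f(x_{i+1})\right)-\frac18\sum_{i=0}^{n-1}h_i^2\left(f'(x_{i+1})-f'(x_i)\right)$$ and the remainder term $R_T(f,f',I_n)$ satisfies $$\left|R_T(f,f',I_n)\right|\leq\sum_{i=0}^{n-1}\frac{h_i^2}{8}\|f''\|_1 .$$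
   Context: Here $\|f''\|_1=\int_a^b|f''(t)|\,dt$, taken over the whole interval $(a,b)$. The symbols $f'(a)$ and $f'(b)$ denote the one-sided derivatives of $f$ at the endpoints. *)

theory Defs
  imports "HOL-Analysis.Analysis"
begin

definition division :: "real \<Rightarrow> real \<Rightarrow> nat \<Rightarrow> (nat \<Rightarrow> real) \<Rightarrow> bool" where
  "division a b n x \<longleftrightarrow> x 0 = a \<and> x n = b \<and> (\<forall>i<n. x i < x (Suc i))"

definition perturbed_trapezoid ::
    "(real \<Rightarrow> real) \<Rightarrow> (real \<Rightarrow> real) \<Rightarrow> nat \<Rightarrow> (nat \<Rightarrow> real) \<Rightarrow> real" where
  "perturbed_trapezoid f f' n x =
     1 / 2 * (\<Sum>i<n. (x (Suc i) - x i) * (f (x i) + f (x (Suc i))))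
     - 1 / 8 * (\<Sum>i<n. (x (Suc i) - x i)\<^sup>2 * (f' (x (Suc i)) - f' (x i)))"

definition L1_norm_on :: "real set \<Rightarrow> (real \<Rightarrow> real) \<Rightarrow> real" where
  "L1_norm_on A g = (LINT t:A|lebesgue. \<bar>g t\<bar>)"

end

theory Submission
  imports Defs
begin

text \<open>
  On a single cell \<open>[c, d]\<close> with midpoint \<open>m\<close> and length \<open>h\<close>, two integrations by parts are
  combined into one primitive: the derivative of
  \<open>(t - m) f(t) - (t - m)\<^sup>2 / 2 \<cdot> f'(t)\<close> is \<open>f(t) - (t - m)\<^sup>2 / 2 \<cdot> f''(t)\<close>. Evaluating the
  primitive at \<open>c\<close> and \<open>d\<close> gives exactly the perturbed trapezoidal rule, so the error is
  \<open>\<integral> (t - m)\<^sup>2 / 2 \<cdot> f''(t) dt\<close>, and \<open>(t - m)\<^sup>2 / 2 \<le> h\<^sup>2 / 8\<close>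
  (lemma \<open>perturbed_trapezoid_cell_error\<close>). Summing over the cells, and bounding the
  \<open>L\<^sub>1\<close> norm of \<open>f''\<close> on each cell by the norm on the whole interval, gives the estimate.

  This needs \<open>f'\<close> to be continuous up to the endpoints \<open>a\<close> and \<open>b\<close>, where its values are the
  one-sided derivatives of \<open>f\<close>. Since \<open>f''\<close> is integrable, \<open>f'\<close> agrees inside with a constant
  plus an indefinite integral of \<open>f''\<close>, hence extends continuously to \<open>[a, b]\<close>
  (lemma \<open>continuous_primitive_of_integrable_derivative\<close>); and since \<open>f\<close> is an indefinite integral
  of that extension, the values of the extension at \<open>a\<close> and \<open>b\<close> are one-sided derivatives of
  \<open>f\<close> (lemma \<open>has_vector_derivative_of_continuous_interior_derivative\<close>).
\<close>

text \<open>The indefinite integral of \<open>g'\<close> is continuous up to the ends and differs from \<open>g\<close> by a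
  constant inside, so integrability of \<open>g'\<close> alone gives \<open>g\<close> limits at \<open>a\<close> and \<open>b\<close>.\<close>

lemma continuous_primitive_of_integrable_derivative:
  fixes a b :: real and g g' :: "real \<Rightarrow> real"
  assumes "a < b"
    and deriv: "\<And>t. t \<in> {a<..<b} \<Longrightarrow> (g has_real_derivative g' t) (at t)"
    and int: "g' integrable_on {a..b}"
  obtains G where "continuous_on {a..b} G" "\<And>t. t \<in> {a<..<b} \<Longrightarrow> G t = g t"
proof
  define p where "p = (a + b) / 2"
  have p: "a < p" "p < b" using \<open>a < b\<close> by (auto simp: p_def)
  define I where "I t = integral {a..t} g'" for t
  have increment: "g t - g s = I t - I s" if "a < s" "s \<le> t" "t < b" for s t
  proof -
    have "(g' has_integral g t - g s) {s..t}"
      using that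
      by (intro fundamental_theorem_of_calculus)
         (auto simp: has_real_derivative_iff_has_vector_derivative[symmetric]
               intro!: has_field_derivative_at_within[OF deriv])
    hence "integral {s..t} g' = g t - g s" by (rule integral_unique)
    moreover have "g' integrable_on {a..t}"
      using int by (rule integrable_on_subinterval) (use that in auto)
    hence "I s + integral {s..t} g' = I t"
      unfolding I_def using that by (intro Henstock_Kurzweil_Integration.integral_combine) auto
    ultimately show ?thesis by simp
  qed
  show "continuous_on {a..b} (\<lambda>t. I t + (g p - I p))"
    unfolding I_def by (intro continuous_intros indefinite_integral_continuous_1 int)
  show "I t + (g p - I p) = g t" if "t \<in> {a<..<b}" for t
    using increment[of t p] increment[of p t] that p by (cases "t \<le> p") auto
qed

text \<open>By the fundamental theorem of calculus \<open>f\<close> is an indefinite integral of \<open>g\<close>, and an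
  indefinite integral of a continuous function is differentiable at the ends as well.\<close>

lemma has_vector_derivative_of_continuous_interior_derivative:
  fixes a b :: real and f g :: "real \<Rightarrow> real"
  assumes "continuous_on {a..b} f" "continuous_on {a..b} g"
    and deriv: "\<And>t. t \<in> {a<..<b} \<Longrightarrow> (f has_real_derivative g t) (at t)"
    and t: "t \<in> {a..b}"
  shows "(f has_vector_derivative g t) (at t within {a..b})"
proof -
  have primitive: "f a + integral {a..s} g = f s" if "s \<in> {a..b}" for s
  proof -
    have "(g has_integral f s - f a) {a..s}"
      using that assms(1)
      by (intro fundamental_theorem_of_calculus_interior)
         (auto simp: has_real_derivative_iff_has_vector_derivative[symmetric]
               intro: deriv continuous_on_subset)
    thus ?thesis by (simp add: integral_unique)
  qed
  have "((\<lambda>s. f a + integral {a..s} g) has_vector_derivative 0 + g t) (at t within {a..b})"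
    using assms(2) t
    by (intro has_vector_derivative_add has_vector_derivative_const integral_has_vector_derivative)
  thus ?thesis
    using has_vector_derivative_transform[OF t primitive[symmetric]] by simp
qed

text \<open>The error is the integral of \<open>f''\<close> against the kernel \<open>(t - m)\<^sup>2 / 2\<close>, where \<open>m\<close> is the
  midpoint. The kernel attains its maximum \<open>(d - c)\<^sup>2 / 8\<close> at both ends of the cell, which is why
  \<open>f'\<close> enters only through \<open>f' d - f' c\<close> and why the same factor appears in the bound.\<close>

lemma perturbed_trapezoid_cell_error:
  fixes c d :: real and f f' f'' :: "real \<Rightarrow> real"
  assumes "c \<le> d" and f: "continuous_on {c..d} f" and f': "continuous_on {c..d} f'"
    and df: "\<And>t. t \<in> {c<..<d} \<Longrightarrow> (f has_real_derivative f' t) (at t)"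
    and df': "\<And>t. t \<in> {c<..<d} \<Longrightarrow> (f' has_real_derivative f'' t) (at t)"
    and abs_int: "(\<lambda>t. \<bar>f'' t\<bar>) integrable_on {c..d}"
  shows "\<bar>integral {c..d} f - ((d - c) * (f c + f d) / 2 - (d - c)\<^sup>2 * (f' d - f' c) / 8)\<bar>
           \<le> (d - c)\<^sup>2 / 8 * integral {c..d} (\<lambda>t. \<bar>f'' t\<bar>)"
proof -
  define m where "m = (c + d) / 2"
  define F where "F t = (t - m) * f t - (t - m)\<^sup>2 / 2 * f' t" for t
  have primitive: "((\<lambda>t. f t - (t - m)\<^sup>2 / 2 * f'' t) has_integral F d - F c) {c..d}"
  proof (rule fundamental_theorem_of_calculus_interior[OF \<open>c \<le> d\<close>])
    show "continuous_on {c..d} F"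
      unfolding F_def by (intro continuous_intros f f') auto
    fix t assume t: "t \<in> {c<..<d}"
    have "(F has_real_derivative f t - (t - m)\<^sup>2 / 2 * f'' t) (at t)"
      unfolding F_def
      by ((rule derivative_eq_intros df[OF t] df'[OF t] refl | simp)+, simp add: field_simps)
    thus "(F has_vector_derivative f t - (t - m)\<^sup>2 / 2 * f'' t) (at t)"
      by (simp add: has_real_derivative_iff_has_vector_derivative)
  qed
  have "(f has_integral integral {c..d} f) {c..d}"
    using f by (intro integrable_integral integrable_continuous_real)
  from has_integral_diff[OF this primitive] have kernel:
    "((\<lambda>t. (t - m)\<^sup>2 / 2 * f'' t) has_integral integral {c..d} f - (F d - F c)) {c..d}"
    by simp
  have weight: "(t - m)\<^sup>2 / 2 \<le> (d - c)\<^sup>2 / 8" if "t \<in> {c..d}" for t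
  proof -
    have "\<bar>t - m\<bar> \<le> (d - c) / 2"
      using that unfolding m_def abs_le_iff atLeastAtMost_iff by (simp add: field_simps)
    hence "\<bar>t - m\<bar>\<^sup>2 \<le> ((d - c) / 2)\<^sup>2"
      by (rule power_mono) simp
    thus ?thesis by (simp add: power_divide)
  qed
  have "norm (integral {c..d} (\<lambda>t. (t - m)\<^sup>2 / 2 * f'' t))
          \<le> integral {c..d} (\<lambda>t. (d - c)\<^sup>2 / 8 * \<bar>f'' t\<bar>)"
  proof (rule integral_norm_bound_integral)
    show "(\<lambda>t. (t - m)\<^sup>2 / 2 * f'' t) integrable_on {c..d}" using kernel by blast
    show "(\<lambda>t. (d - c)\<^sup>2 / 8 * \<bar>f'' t\<bar>) integrable_on {c..d}"
      using abs_int by (rule integrable_on_mult_right)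
    show "norm ((t - m)\<^sup>2 / 2 * f'' t) \<le> (d - c)\<^sup>2 / 8 * \<bar>f'' t\<bar>" if "t \<in> {c..d}" for t
      using mult_right_mono[OF weight[OF that], of "\<bar>f'' t\<bar>"] by (simp add: abs_mult)
  qed
  moreover have "F d - F c = (d - c) * (f c + f d) / 2 - (d - c)\<^sup>2 * (f' d - f' c) / 8"
    by (simp add: F_def m_def field_simps power2_eq_square)
  ultimately show ?thesis
    unfolding integral_unique[OF kernel] real_norm_def by (simp only: integral_mult_right)
qed

lemma division_bounds:
  assumes "division a b n x" and "i \<le> n"
  shows "a \<le> x i" and "x i \<le> b"
proof -
  have increasing: "x k \<le> x (Suc k)" if "k < n" for k
    using assms(1) that by (simp add: division_def less_imp_le)
  have mono: "x j \<le> x k" if "j \<le> k" "k \<le> n" for j k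
    using that
  proof (induction rule: dec_induct)
    case (step k)
    thus ?case using increasing[of k] by simp
  qed simp
  show "a \<le> x i" "x i \<le> b"
    using mono[of 0 i] mono[of i n] assms by (auto simp: division_def)
qed

lemma integral_eq_sum_over_division:
  fixes f :: "real \<Rightarrow> real"
  assumes div: "division a b n x" and f: "f integrable_on {a..b}"
  shows "integral {a..b} f = (\<Sum>i<n. integral {x i..x (Suc i)} f)"
proof -
  have "integral {a..x k} f = (\<Sum>i<k. integral {x i..x (Suc i)} f)" if "k \<le> n" for k
    using that
  proof (induction k)
    case 0
    show ?case using div by (simp add: division_def)
  next
    case (Suc k)
    have "f integrable_on {a..x (Suc k)}"
      using f by (rule integrable_on_subinterval) (use division_bounds[OF div] Suc in auto)
    hence "integral {a..x k} f + integral {x k..x (Suc k)} f = integral {a..x (Suc k)} f"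
      using division_bounds(1)[OF div, of k] div Suc.prems
      by (intro Henstock_Kurzweil_Integration.integral_combine) (auto simp: division_def less_imp_le)
    thus ?case using Suc by simp
  qed
  from this[of n] show ?thesis using div by (simp add: division_def)
qed

theorem corollary11:
  fixes a b :: real and f f' f'' :: "real \<Rightarrow> real" and n :: nat and x :: "nat \<Rightarrow> real"
  assumes "a < b"
    and "continuous_on {a..b} f"
    and "\<And>t. t \<in> {a<..<b} \<Longrightarrow> (f has_real_derivative f' t) (at t)"
    and "\<And>t. t \<in> {a<..<b} \<Longrightarrow> (f' has_real_derivative f'' t) (at t)"
    and "f' a = vector_derivative f (at_right a)"
    and "f' b = vector_derivative f (at_left b)"
    and "f'' absolutely_integrable_on {a<..<b}"
    and "division a b n x"
  shows "\<exists>R. integral {a..b} f = perturbed_trapezoid f f' n x + R \<and>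
             \<bar>R\<bar> \<le> (\<Sum>i<n. (x (Suc i) - x i)\<^sup>2 / 8 * L1_norm_on {a<..<b} f'')"
proof -
  have int: "f'' integrable_on {a..b}" and abs_int: "(\<lambda>t. \<bar>f'' t\<bar>) integrable_on {a..b}"
    using assms(7) by (auto simp: absolutely_integrable_on_def integrable_on_Icc_iff_Ioo)
  have "L1_norm_on {a<..<b} f'' = integral {a<..<b} (\<lambda>t. \<bar>f'' t\<bar>)"
    unfolding L1_norm_on_def
    using set_lebesgue_integral_eq_integral(2)[OF set_integrable_abs[OF assms(7)]] .
  hence L1: "L1_norm_on {a<..<b} f'' = integral {a..b} (\<lambda>t. \<bar>f'' t\<bar>)"
    by (simp add: integral_open_interval_real)

  \<comment> \<open>The continuous extension of \<open>f'\<close> from the interior agrees with \<open>f'\<close> at \<open>a\<close> and \<open>b\<close>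
      as well, because one-sided derivatives are unique.\<close>
  obtain G where G: "continuous_on {a..b} G" and G_eq: "\<And>t. t \<in> {a<..<b} \<Longrightarrow> G t = f' t"
    using continuous_primitive_of_integrable_derivative[OF assms(1,4) int] by blast
  have dG: "(f has_vector_derivative G t) (at t within {a..b})" if "t \<in> {a..b}" for t
    using has_vector_derivative_of_continuous_interior_derivative[OF assms(2) G _ that]
      assms(3) G_eq by simp
  have "G a = f' a"
    using dG[of a] \<open>a < b\<close> assms(5)
    by (simp add: at_within_Icc_at_right vector_derivative_within trivial_limit_at_right_real)
  moreover have "G b = f' b"
    using dG[of b] \<open>a < b\<close> assms(6)
    by (simp add: at_within_Icc_at_left vector_derivative_within trivial_limit_at_left_real)
  ultimately have "G t = f' t" if "t \<in> {a..b}" for t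
    using G_eq[of t] that by (cases "t = a \<or> t = b") auto
  hence f': "continuous_on {a..b} f'"
    using G continuous_on_cong[of "{a..b}" "{a..b}" f' G] by simp

  define rule where "rule i = (x (Suc i) - x i) * (f (x i) + f (x (Suc i))) / 2
    - (x (Suc i) - x i)\<^sup>2 * (f' (x (Suc i)) - f' (x i)) / 8" for i
  have cell: "\<bar>integral {x i..x (Suc i)} f - rule i\<bar>
      \<le> (x (Suc i) - x i)\<^sup>2 / 8 * L1_norm_on {a<..<b} f''" if "i < n" for i
  proof -
    have le: "a \<le> x i" "x i \<le> x (Suc i)" "x (Suc i) \<le> b"
      using division_bounds[OF assms(8)] assms(8) that by (auto simp: division_def less_imp_le)
    have sub: "{x i..x (Suc i)} \<subseteq> {a..b}" using le by auto
    have abs_int_cell: "(\<lambda>t. \<bar>f'' t\<bar>) integrable_on {x i..x (Suc i)}"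
      using abs_int sub by (rule integrable_on_subinterval)
    have "\<bar>integral {x i..x (Suc i)} f - rule i\<bar>
        \<le> (x (Suc i) - x i)\<^sup>2 / 8 * integral {x i..x (Suc i)} (\<lambda>t. \<bar>f'' t\<bar>)"
      unfolding rule_def using le assms(2) f' sub
      by (intro perturbed_trapezoid_cell_error abs_int_cell assms(3,4))
         (auto intro: continuous_on_subset)
    also have "\<dots> \<le> (x (Suc i) - x i)\<^sup>2 / 8 * L1_norm_on {a<..<b} f''"
      unfolding L1
      by (intro mult_left_mono integral_subset_le sub abs_int_cell abs_int) auto
    finally show ?thesis .
  qed

  have "integral {a..b} f - perturbed_trapezoid f f' n x
      = (\<Sum>i<n. integral {x i..x (Suc i)} f - rule i)"
    using integral_eq_sum_over_division[OF assms(8) integrable_continuous_real[OF assms(2)]]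
    by (simp add: perturbed_trapezoid_def rule_def sum_subtractf sum_divide_distrib)
  moreover have "\<bar>\<Sum>i<n. integral {x i..x (Suc i)} f - rule i\<bar>
      \<le> (\<Sum>i<n. (x (Suc i) - x i)\<^sup>2 / 8 * L1_norm_on {a<..<b} f'')"
    using cell by (intro order_trans[OF sum_abs] sum_mono) auto
  ultimately show ?thesis
    by (intro exI[of _ "integral {a..b} f - perturbed_trapezoid f f' n x"]) simp
qed

end
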